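(* Fix $\lambda>0$, $\bar u>0$ and $\bar c>0$. For $b\in[0,\bar u]$, let $\tilde F_u(b)$ be the cache-update-rate-optimized freshness of a file in a two-cache system with user rates $u_1=\bar u-b$, $u_2=\bar u+b$ and total cache rate $2\bar c$. Then $\tilde F_u(b)$ is an increasing function of $b$ on $[0,\bar u]$.
   Context: In a two-cache parallel system, a file has source update rate $\lambda$, source-to-cache update rates $c_1,c_2\ge0$ and cache-to-user update rates $u_1,u_2\ge0$ (all inter-update times independent exponentials), and its freshness at the user (long-run fraction of time the user has the version currently at the source) is $$F_u(c_1,c_2,u_1,u_2)=\frac{(u_1+u_2)(c_1+c_2)}{(\lambda+u_1+u_2)(\lambda+c_1+c_2)}-\frac{\lambda}{(\lambda+u_1+u_2)(\lambda+c_1+c_2)}\left(\frac{u_2c_1}{\lambda+u_1+c_2}+\frac{u_1c_2}{\lambda+u_2+c_1}\right).$$ The cache-update-rate-optimized freshness $\tilde F_u$ is obtained, for fixed $u_1,u_2$ and fixed total cache rate $2\bar c$, by inserting the optimal cache rates $c_1^*,c_2^*$, i.e. those maximizing $F_u$ over $c_1,c_2\ge 0$ with $c_1+c_2=2\bar c$. Thus $\tilde F_u(b)=\max_{-\bar c\le a\le \bar c}F_u(\bar c-a,\bar c+a,\bar u-b,\bar u+b)$. *)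

theory Defs
  imports Complex_Main
begin

(* Closed form of the long-run fraction of time the user holds the source's current version,
   for source update rate lam, source-to-cache rates c1, c2 and cache-to-user rates u1, u2,
   all inter-update times being independent exponentials. *)

definition user_freshness :: "real \<Rightarrow> real \<Rightarrow> real \<Rightarrow> real \<Rightarrow> real \<Rightarrow> real" where
  "user_freshness lam c1 c2 u1 u2 =
     ((u1 + u2) * (c1 + c2)) / ((lam + u1 + u2) * (lam + c1 + c2))
     - lam / ((lam + u1 + u2) * (lam + c1 + c2))
       * (u2 * c1 / (lam + u1 + c2) + u1 * c2 / (lam + u2 + c1))"

definition feasible_cache_rates :: "real \<Rightarrow> real \<times> real \<Rightarrow> bool" where
  "feasible_cache_rates C = (\<lambda>(c1, c2). 0 \<le> c1 \<and> 0 \<le> c2 \<and> c1 + c2 = C)"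

definition optimal_cache_rates :: "real \<Rightarrow> real \<Rightarrow> real \<Rightarrow> real \<Rightarrow> real \<times> real" where
  "optimal_cache_rates lam C u1 u2 =
     arg_max (\<lambda>(c1, c2). user_freshness lam c1 c2 u1 u2) (feasible_cache_rates C)"

definition optimized_freshness :: "real \<Rightarrow> real \<Rightarrow> real \<Rightarrow> real \<Rightarrow> real" where
  "optimized_freshness lam C u1 u2 =
     (case optimal_cache_rates lam C u1 u2 of (c1, c2) \<Rightarrow> user_freshness lam c1 c2 u1 u2)"

(* A maximizer exists, so the choice made by arg_max is a genuine optimum. *)

lemma optimal_cache_rates_is_arg_max:
  assumes "lam > 0" "C \<ge> 0" "u1 \<ge> 0" "u2 \<ge> 0"
  shows "is_arg_max (\<lambda>(c1, c2). user_freshness lam c1 c2 u1 u2) (feasible_cache_rates C)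
           (optimal_cache_rates lam C u1 u2)"
proof -
  let ?g = "\<lambda>x. user_freshness lam x (C - x) u1 u2"
  have "continuous_on {0..C} ?g"
    unfolding user_freshness_def using assms
    by (intro continuous_intros ballI) (auto simp: add_nonneg_eq_0_iff)
  then obtain x where x: "x \<in> {0..C}" "\<forall>y\<in>{0..C}. ?g y \<le> ?g x"
    using continuous_attains_sup[of "{0..C}" ?g] assms by auto
  have "is_arg_max (\<lambda>(c1, c2). user_freshness lam c1 c2 u1 u2) (feasible_cache_rates C) (x, C - x)"
    unfolding is_arg_max_linorder
  proof (intro conjI allI impI)
    show "feasible_cache_rates C (x, C - x)"
      using x(1) by (simp add: feasible_cache_rates_def)
    fix p assume "feasible_cache_rates C p"
    then obtain y where y: "p = (y, C - y)" "y \<in> {0..C}"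
      by (cases p) (auto simp: feasible_cache_rates_def)
    show "(case p of (c1, c2) \<Rightarrow> user_freshness lam c1 c2 u1 u2)
            \<le> (case (x, C - x) of (c1, c2) \<Rightarrow> user_freshness lam c1 c2 u1 u2)"
      using x(2) y by simp
  qed
  then show ?thesis
    unfolding optimal_cache_rates_def arg_max_def by (rule someI)
qed

end

theory Submission
  imports Defs
begin

text \<open>
  Write \<open>c1 = c - a\<close>, \<open>c2 = c + a\<close>, \<open>u1 = u - b\<close>, \<open>u2 = u + b\<close>. Up to constants the freshness is the
  negative of a penalty which, in terms of \<open>t = a - b\<close> and \<open>S = \<lambda> + u + c\<close>, equals
  \<open>2 (S (u (S + c) - b\<^sup>2) - t b (\<lambda> + 2 c)) / (S\<^sup>2 - t\<^sup>2) - 2 u\<close>.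
  It decreases in \<open>t\<close> for \<open>t \<le> 0\<close>, so one may assume \<open>t \<ge> 0\<close> or \<open>a = c\<close>. For fixed \<open>t \<ge> 0\<close> it
  strictly decreases in \<open>b\<close>, and so it does for fixed \<open>a = c\<close>. Hence, when \<open>b\<close> grows, keeping \<open>t\<close>
  until \<open>a\<close> reaches \<open>c\<close>, and keeping \<open>a = c\<close> from then on, strictly improves an optimal choice of \<open>a\<close>.
\<close>

definition penalty :: "real \<Rightarrow> real \<Rightarrow> real \<Rightarrow> real \<Rightarrow> real \<Rightarrow> real" where
  "penalty lam u c a b =
     (u + b) * (c - a) / (lam + (u - b) + (c + a)) + (u - b) * (c + a) / (lam + (u + b) + (c - a))"

lemma user_freshness_eq_penalty:
  "user_freshness lam (c - a) (c + a) (u - b) (u + b) =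
     (2 * u) * (2 * c) / ((lam + 2 * u) * (lam + 2 * c))
     - lam / ((lam + 2 * u) * (lam + 2 * c)) * penalty lam u c a b"
proof -
  have "u - b + (u + b) = 2 * u" "c - a + (c + a) = 2 * c"
    "lam + (u - b) + (u + b) = lam + 2 * u" "lam + (c - a) + (c + a) = lam + 2 * c"
    by simp_all
  then show ?thesis
    unfolding user_freshness_def penalty_def by (simp only:)
qed

text \<open>Both fractions are put over \<open>(S + t) * (S - t)\<close>. Rewriting
  \<open>lam\<close> and \<open>a\<close> through \<open>S\<close> and \<open>t\<close> leaves
  \<open>b\<close> in the numerator only, so moves with \<open>t\<close> fixed keep the
  denominator.\<close>

lemma penalty_eq:
  assumes "S = lam + u + c" "t = a - b" "S + t \<noteq> 0" "S - t \<noteq> 0"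
  shows "penalty lam u c a b =
           2 * (S * (u * (S + c) - b\<^sup>2) - t * b * (lam + 2 * c)) / (S\<^sup>2 - t\<^sup>2) - 2 * u"
proof -
  have lam: "lam = S - u - c" and a: "a = t + b" using assms by simp_all
  have "lam + (u - b) + (c + a) = S + t" "lam + (u + b) + (c - a) = S - t"
    using assms by simp_all
  then have "penalty lam u c a b = (u + b) * (c - a) / (S + t) + (u - b) * (c + a) / (S - t)"
    unfolding penalty_def by simp
  also have "\<dots> = ((u + b) * (c - a) * (S - t) + (u - b) * (c + a) * (S + t)) / ((S + t) * (S - t))"
    using assms(3,4) by (simp add: add_frac_eq)
  also have "(u + b) * (c - a) * (S - t) + (u - b) * (c + a) * (S + t) =
      2 * (S * (u * (S + c) - b\<^sup>2) - t * b * (lam + 2 * c)) - 2 * u * ((S + t) * (S - t))"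
    unfolding lam a by (simp add: algebra_simps power2_eq_square)
  also have "(\<dots>) / ((S + t) * (S - t)) =
      2 * (S * (u * (S + c) - b\<^sup>2) - t * b * (lam + 2 * c)) / ((S + t) * (S - t)) - 2 * u"
    using assms(3,4) by (simp add: diff_divide_distrib)
  also have "(S + t) * (S - t) = S\<^sup>2 - t\<^sup>2"
    by (simp add: algebra_simps power2_eq_square)
  finally show ?thesis .
qed

text \<open>As \<open>t\<close> rises towards 0, the denominator
  \<open>S\<^sup>2 - t\<^sup>2\<close> grows and the numerator shrinks while \<open>t * b\<close>
  increases.\<close>

lemma penalty_antimono_left:
  assumes "lam > 0" "c \<ge> 0" "0 \<le> b" "b \<le> u" "- c \<le> a" "a \<le> a'" "a' \<le> b"
  shows "penalty lam u c a' b \<le> penalty lam u c a b"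
proof -
  define S t t' where "S = lam + u + c" and "t = a - b" and "t' = a' - b"
  have t: "t \<le> t'" "t' \<le> 0" "- S < t" and "0 < S"
    using assms by (simp_all add: S_def t_def t'_def)
  \<comment> \<open>Comes from \<open>b \<le> u \<le> S + c\<close>; it makes the numerator
    nonnegative, without which a larger denominator need not lower the quotient.\<close>
  have "b\<^sup>2 \<le> u * (S + c)"
    unfolding power2_eq_square using assms by (intro mult_mono) (auto simp: S_def)
  then have "0 \<le> S * (u * (S + c) - b\<^sup>2)"
    using \<open>0 < S\<close> by simp
  moreover have le: "t' * b * (lam + 2 * c) \<le> 0" "t * b * (lam + 2 * c) \<le> t' * b * (lam + 2 * c)"
    using assms t by (auto intro!: mult_right_mono mult_nonpos_nonneg)
  then have "t * b * (lam + 2 * c) \<le> 0" by (rule order_trans[rotated])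
  ultimately have
    "0 \<le> 2 * (S * (u * (S + c) - b\<^sup>2) - t * b * (lam + 2 * c))"
    by (intro mult_nonneg_nonneg) (auto simp only: diff_ge_0_iff_ge zero_le_numeral intro: order_trans)
  moreover have "2 * (S * (u * (S + c) - b\<^sup>2) - t' * b * (lam + 2 * c))
       \<le> 2 * (S * (u * (S + c) - b\<^sup>2) - t * b * (lam + 2 * c))"
    using le(2) by (intro mult_left_mono diff_left_mono) auto
  moreover have "t'\<^sup>2 \<le> t\<^sup>2" "t\<^sup>2 < S\<^sup>2"
    using t \<open>0 < S\<close> by (simp_all add: abs_le_square_iff[symmetric] power2_strict_mono)
  ultimately show ?thesis
    using t by (subst (1 2) penalty_eq[OF S_def]) (auto simp: t_def t'_def intro!: frac_le)
qed

text \<open>Here \<open>t\<close> is constant: the term in \<open>b\<^sup>2\<close> gives the strict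
  decrease, and \<open>t \<ge> 0\<close> keeps the linear term from working against it.\<close>

lemma penalty_strict_antimono_diagonal:
  assumes "lam > 0" "c \<ge> 0" "u \<ge> 0" "0 \<le> b" "b < b'" "b \<le> a" "a \<le> c"
  shows "penalty lam u c (a + (b' - b)) b' < penalty lam u c a b"
proof -
  define S t where "S = lam + u + c" and "t = a - b"
  have t: "0 \<le> t" "t < S" "0 < S"
    using assms by (simp_all add: S_def t_def)
  have "b\<^sup>2 < b'\<^sup>2" "t * b * (lam + 2 * c) \<le> t * b' * (lam + 2 * c)"
    using assms t by (auto intro!: power_strict_mono mult_right_mono mult_left_mono)
  moreover have "S * (u * (S + c) - b'\<^sup>2) < S * (u * (S + c) - b\<^sup>2)"
    using \<open>b\<^sup>2 < b'\<^sup>2\<close> t by simp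
  moreover have "0 < S\<^sup>2 - t\<^sup>2"
    using t by (simp add: power_strict_mono)
  ultimately have
    "2 * (S * (u * (S + c) - b'\<^sup>2) - t * b' * (lam + 2 * c)) / (S\<^sup>2 - t\<^sup>2)
       < 2 * (S * (u * (S + c) - b\<^sup>2) - t * b * (lam + 2 * c)) / (S\<^sup>2 - t\<^sup>2)"
    by (intro divide_strict_right_mono) auto
  moreover have "t = a + (b' - b) - b'" by (simp add: t_def)
  ultimately show ?thesis
    using t penalty_eq[OF S_def t_def] penalty_eq[OF S_def \<open>t = a + (b' - b) - b'\<close>] by simp
qed

text \<open>At \<open>a = c\<close> the first cache has rate 0, so one fraction vanishes; the other
  loses numerator and gains denominator.\<close>

lemma penalty_strict_antimono_boundary:
  assumes "lam > 0" "c > 0" "0 \<le> b" "b < b'" "b' \<le> u"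
  shows "penalty lam u c c b' < penalty lam u c c b"
proof -
  have "(u - b') * (c + c) / (lam + (u + b')) < (u - b) * (c + c) / (lam + (u + b))"
    using assms by (intro frac_less) auto
  then show ?thesis by (simp add: penalty_def)
qed

text \<open>Improving an arbitrary \<open>a\<close> avoids solving for the optimal rates.\<close>

lemma exists_smaller_penalty:
  assumes "lam > 0" "c > 0" "0 \<le> b" "b < b'" "b' \<le> u" "- c \<le> a" "a \<le> c"
  shows "\<exists>a'. - c \<le> a' \<and> a' \<le> c \<and> penalty lam u c a' b' < penalty lam u c a b"
proof -
  \<comment> \<open>If \<open>a < b\<close>, push \<open>a\<close> right up to \<open>b\<close>,
    stopping at \<open>c\<close> in case \<open>b > c\<close>.\<close>
  define a0 where "a0 = max a (min b c)"
  have a0: "- c \<le> a0" "a0 \<le> c" "b \<le> a0 \<or> a0 = c"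
    using assms by (auto simp: a0_def)
  have le: "penalty lam u c a0 b \<le> penalty lam u c a b"
  proof (cases "a0 = a")
    case False
    then show ?thesis
      using assms by (intro penalty_antimono_left) (auto simp: a0_def)
  qed simp
  consider "a0 = c" | "b \<le> a0" "a0 + (b' - b) \<le> c" | "b \<le> a0" "a0 < c" "c < a0 + (b' - b)"
    using a0 by linarith
  then show ?thesis
  proof cases
    case 1
    then show ?thesis
      using le penalty_strict_antimono_boundary[of lam c b b' u] assms by (intro exI[of _ c]) auto
  next
    case 2
    then show ?thesis
      using le penalty_strict_antimono_diagonal[of lam c u b b' a0] assms a0
      by (intro exI[of _ "a0 + (b' - b)"]) auto
  next
    case 3
    \<comment> \<open>\<open>d\<close> is where the diagonal through \<open>(a0, b)\<close> meets
      the boundary \<open>a = c\<close>, before \<open>b'\<close> is reached.\<close>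
    define d where "d = b + (c - a0)"
    have d: "b < d" "d < b'" "a0 + (d - b) = c" using 3 by (auto simp: d_def)
    have "penalty lam u c c b' < penalty lam u c c d"
      using assms d by (intro penalty_strict_antimono_boundary) auto
    also have "\<dots> < penalty lam u c a0 b"
      using penalty_strict_antimono_diagonal[of lam c u b d a0] assms 3 d by simp
    finally show ?thesis
      using le assms by (intro exI[of _ c]) auto
  qed
qed

theorem lemma2:
  fixes lam ubar cbar :: real
  assumes "lam > 0" and "ubar > 0" and "cbar > 0"
  shows "strict_mono_on {0..ubar}
           (\<lambda>b. optimized_freshness lam (2 * cbar) (ubar - b) (ubar + b))"
proof (rule strict_mono_onI)
  fix b b' assume b: "b \<in> {0..ubar}" "b' \<in> {0..ubar}" "b < b'"
  let ?F = "\<lambda>a b. user_freshness lam (cbar - a) (cbar + a) (ubar - b) (ubar + b)"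
  \<comment> \<open>Attainment at \<open>b\<close> supplies one point to improve, which keeps the
    inequality strict; maximality at \<open>b'\<close> bounds the improved value.\<close>
  have opt: "is_arg_max (\<lambda>(c1, c2). user_freshness lam c1 c2 (ubar - x) (ubar + x))
      (feasible_cache_rates (2 * cbar)) (optimal_cache_rates lam (2 * cbar) (ubar - x) (ubar + x))"
    if "x \<in> {0..ubar}" for x
    using assms that by (intro optimal_cache_rates_is_arg_max) auto
  obtain c1 c2 where c: "optimal_cache_rates lam (2 * cbar) (ubar - b) (ubar + b) = (c1, c2)"
    by fastforce
  have "feasible_cache_rates (2 * cbar) (c1, c2)"
    using opt[OF b(1)] c by (simp add: is_arg_max_linorder)
  then have c12: "0 \<le> c1" "0 \<le> c2" "c1 + c2 = 2 * cbar"
    by (auto simp: feasible_cache_rates_def)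
  define a where "a = cbar - c1"
  have a: "- cbar \<le> a" "a \<le> cbar" "c1 = cbar - a" "c2 = cbar + a"
    using c12 by (auto simp: a_def)
  obtain a' where a': "- cbar \<le> a'" "a' \<le> cbar"
    "penalty lam ubar cbar a' b' < penalty lam ubar cbar a b"
    using exists_smaller_penalty[of lam cbar b b' ubar a] assms b a by auto
  have "optimized_freshness lam (2 * cbar) (ubar - b) (ubar + b) = ?F a b"
    by (simp add: optimized_freshness_def c a)
  also have "\<dots> < ?F a' b'"
  proof -
    have "0 < lam / ((lam + 2 * ubar) * (lam + 2 * cbar))"
      using assms by simp
    from mult_strict_left_mono[OF a'(3) this] show ?thesis
      unfolding user_freshness_eq_penalty by (rule diff_strict_left_mono)
  qed
  also have "\<dots> \<le> optimized_freshness lam (2 * cbar) (ubar - b') (ubar + b')"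
  proof -
    have "feasible_cache_rates (2 * cbar) (cbar - a', cbar + a')"
      using a' by (simp add: feasible_cache_rates_def)
    then show ?thesis
      using opt[OF b(2)] by (fastforce simp: is_arg_max_linorder optimized_freshness_def)
  qed
  finally show "optimized_freshness lam (2 * cbar) (ubar - b) (ubar + b)
      < optimized_freshness lam (2 * cbar) (ubar - b') (ubar + b')" .
qed

end
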